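(* Let $G$ be a finite group with center $Z(G)$. If $G/Z(G)$ is either a Frobenius group or a $2$-Frobenius group, then the commuting graph $\Gamma(G)$ is disconnected.
   Context: For a finite group $G$, the commuting graph $\Gamma(G)$ is the graph whose vertex set is the set $G \setminus Z(G)$ of noncentral elements, two distinct vertices being adjacent if and only if they commute in $G$. A graph is connected if any two of its vertices are joined by a path, and disconnected otherwise. A finite group $H$ is a Frobenius group if it contains a proper nontrivial subgroup $A$ (a Frobenius complement) such that $A \cap A^h = 1$ for all $h \in H \setminus A$. In this case $N = (H \setminus \bigcup_{h \in H} A^h) \cup \{1\}$ is a normal subgroup of $H$, called the Frobenius kernel. A finite group $H$ is a $2$-Frobenius group if there exist normal subgroups $K \le L$ of $H$ such that $L$ is a Frobenius group with Frobenius kernel $K$ and $H/K$ is a Frobenius group with Frobenius kernel $L/K$. *)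

theory Defs
  imports "HOL-Algebra.Coset" "Graph_Theory.Graph_Theory"
begin

definition center :: "('a, 'b) monoid_scheme \<Rightarrow> 'a set" where
  "center G = {z \<in> carrier G. \<forall>g \<in> carrier G. z \<otimes>\<^bsub>G\<^esub> g = g \<otimes>\<^bsub>G\<^esub> z}"

lemma (in group) center_normal: "center G \<lhd> G"
proof -
  have sub: "subgroup (center G) G"
  proof (rule subgroupI)
    show "center G \<subseteq> carrier G" and "center G \<noteq> {}"
      by (auto simp: center_def)
  next
    fix z assume z: "z \<in> center G"
    then have zG: "z \<in> carrier G"
      by (simp add: center_def)
    have "inv z \<otimes> g = g \<otimes> inv z" if g: "g \<in> carrier G" for g
    proof -
      have "z \<otimes> inv g = inv g \<otimes> z"
        using z g by (simp add: center_def)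
      then have "inv (z \<otimes> inv g) = inv (inv g \<otimes> z)"
        by simp
      then show ?thesis
        using zG g by (simp add: inv_mult_group)
    qed
    then show "inv z \<in> center G"
      using zG by (simp add: center_def)
  next
    fix x y assume x: "x \<in> center G" and y: "y \<in> center G"
    then have xy: "x \<in> carrier G" "y \<in> carrier G"
      by (simp_all add: center_def)
    have "x \<otimes> y \<otimes> g = g \<otimes> (x \<otimes> y)" if g: "g \<in> carrier G" for g
    proof -
      have "x \<otimes> y \<otimes> g = x \<otimes> (g \<otimes> y)"
        using xy y g by (simp add: m_assoc center_def)
      also have "\<dots> = (x \<otimes> g) \<otimes> y"
        using xy g by (simp add: m_assoc)
      also have "\<dots> = g \<otimes> (x \<otimes> y)"
        using xy x g by (simp add: m_assoc center_def)
      finally show ?thesis .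
    qed
    then show "x \<otimes> y \<in> center G"
      using xy by (simp add: center_def)
  qed
  have "\<forall>x \<in> carrier G. center G #> x = x <# center G"
    unfolding r_coset_def l_coset_def center_def by auto
  with sub show ?thesis
    by (simp add: normal_def normal_axioms_def is_group)
qed

text \<open>An undirected graph is represented by its symmetric set of arcs.\<close>

definition commuting_graph :: "('a, 'b) monoid_scheme \<Rightarrow> 'a pair_pre_digraph" where
  "commuting_graph G =
    \<lparr> pverts = carrier G - center G,
      parcs = {(x, y). x \<in> carrier G - center G \<and> y \<in> carrier G - center G \<and>
                       x \<noteq> y \<and> x \<otimes>\<^bsub>G\<^esub> y = y \<otimes>\<^bsub>G\<^esub> x} \<rparr>"

lemma commuting_graph_pair_graph:
  assumes "finite (carrier G)"
  shows "pair_graph (commuting_graph G)"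
proof
  have "parcs (commuting_graph G) \<subseteq> carrier G \<times> carrier G"
    by (auto simp: commuting_graph_def)
  then show "finite (parcs (commuting_graph G))"
    using assms finite_subset by blast
qed (use assms in \<open>auto simp: commuting_graph_def symmetric_def arcs_ends_def
       arc_to_ends_def sym_def\<close>)

text \<open>
  The library's \<^const>\<open>Digraph_Component.connected\<close> is false for the graph without vertices.
  Here that graph counts as connected (any two of its vertices are joined by a path), so it has
  to be excluded when defining disconnectedness.
\<close>

definition disconnected :: "('a, 'b) pre_digraph \<Rightarrow> bool" where
  "disconnected \<Gamma> \<longleftrightarrow> verts \<Gamma> \<noteq> {} \<and> \<not> Digraph_Component.connected \<Gamma>"

text \<open>The conjugate $A^h = h^{-1} A h$.\<close>

definition conjugate :: "('a, 'b) monoid_scheme \<Rightarrow> 'a set \<Rightarrow> 'a \<Rightarrow> 'a set" where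
  "conjugate H A h = (inv\<^bsub>H\<^esub> h <#\<^bsub>H\<^esub> A) #>\<^bsub>H\<^esub> h"

definition frobenius_complement :: "('a, 'b) monoid_scheme \<Rightarrow> 'a set \<Rightarrow> bool" where
  "frobenius_complement H A \<longleftrightarrow>
     subgroup A H \<and> A \<noteq> {\<one>\<^bsub>H\<^esub>} \<and> A \<noteq> carrier H \<and>
     (\<forall>h \<in> carrier H - A. A \<inter> conjugate H A h = {\<one>\<^bsub>H\<^esub>})"

definition frobenius_kernel :: "('a, 'b) monoid_scheme \<Rightarrow> 'a set \<Rightarrow> 'a set" where
  "frobenius_kernel H A = (carrier H - (\<Union>h \<in> carrier H. conjugate H A h)) \<union> {\<one>\<^bsub>H\<^esub>}"

definition frobenius_group :: "('a, 'b) monoid_scheme \<Rightarrow> bool" where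
  "frobenius_group H \<longleftrightarrow>
     group H \<and> finite (carrier H) \<and> (\<exists>A. frobenius_complement H A)"

definition frobenius_group_with_kernel :: "('a, 'b) monoid_scheme \<Rightarrow> 'a set \<Rightarrow> bool" where
  "frobenius_group_with_kernel H N \<longleftrightarrow>
     group H \<and> finite (carrier H) \<and>
     (\<exists>A. frobenius_complement H A \<and> N = frobenius_kernel H A)"

text \<open>
  For \<open>K \<subseteq> L\<close>, the carrier of \<open>H\<lparr>carrier := L\<rparr> Mod K\<close> is the set of cosets of \<open>K\<close> by elements
  of \<open>L\<close>, that is, $L/K$ as a subset of the carrier of \<open>H Mod K\<close>.
\<close>

definition two_frobenius_group :: "('a, 'b) monoid_scheme \<Rightarrow> bool" where
  "two_frobenius_group H \<longleftrightarrow>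
     group H \<and> finite (carrier H) \<and>
     (\<exists>K L. K \<lhd> H \<and> L \<lhd> H \<and> K \<subseteq> L \<and>
        frobenius_group_with_kernel (H\<lparr>carrier := L\<rparr>) K \<and>
        frobenius_group_with_kernel (H Mod K) (carrier (H\<lparr>carrier := L\<rparr> Mod K)))"

end

theory Submission
  imports Defs
begin

text \<open>
  A nontrivial element \<open>a\<close> of a Frobenius complement \<open>A\<close> commuting with \<open>h\<close> lies in
  \<open>A \<inter> A\<^sup>h\<close>, so \<open>A\<close> contains the centralizers of its nontrivial elements. The same then
  holds for the Frobenius kernel, as it meets no conjugate of \<open>A\<close> outside the
  identity. If $H$ is $2$-Frobenius with respect to
  $K \le L$, an element of $H$ commuting with a nontrivial element of a complement \<open>A\<close> of \<open>L\<close>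
  lies in $L$ by the kernel property of $L/K$ in $H/K$, hence in \<open>A\<close>. In both cases the vertices
  of the commuting graph lying over \<open>A\<close> form a nonempty proper union of connected components,
  since the projection to $G/Z(G)$ preserves commutation.
\<close>

text \<open>For \<open>S\<close> inside \<open>carrier H\<close>, this says that
  \<open>S - {\<one>}\<close> is a union of connected components of the graph in which nonidentity
  elements are joined when they commute. \<open>S\<close> may be any set, so the Frobenius kernel
  can be treated without showing that it is a subgroup.\<close>

definition centralizer_closed :: "('a, 'b) monoid_scheme \<Rightarrow> 'a set \<Rightarrow> bool" where
  "centralizer_closed H S \<longleftrightarrow>
     (\<forall>a \<in> S - {\<one>\<^bsub>H\<^esub>}. \<forall>h \<in> carrier H. a \<otimes>\<^bsub>H\<^esub> h = h \<otimes>\<^bsub>H\<^esub> a \<longrightarrow> h \<in> S)"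

lemma centralizer_closedD:
  assumes "centralizer_closed H S" "a \<in> S" "a \<noteq> \<one>\<^bsub>H\<^esub>" "h \<in> carrier H"
    and "a \<otimes>\<^bsub>H\<^esub> h = h \<otimes>\<^bsub>H\<^esub> a"
  shows "h \<in> S"
  using assms unfolding centralizer_closed_def by blast

lemma (in group) mem_conjugate_iff:
  "x \<in> conjugate G A h \<longleftrightarrow> (\<exists>a \<in> A. x = inv h \<otimes> a \<otimes> h)"
  by (auto simp: conjugate_def l_coset_def r_coset_def)

lemma (in group) conjugate_one:
  assumes "A \<subseteq> carrier G"
  shows "conjugate G A \<one> = A"
  using assms by (force simp: mem_conjugate_iff)

lemma (in group) centralizer_closed_complement:
  assumes "frobenius_complement G A"
  shows "centralizer_closed G A"
  unfolding centralizer_closed_def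
proof (intro ballI impI, rule ccontr)
  fix a h
  assume a: "a \<in> A - {\<one>}" and h: "h \<in> carrier G" and comm: "a \<otimes> h = h \<otimes> a" and "h \<notin> A"
  have aG: "a \<in> carrier G"
    using assms a by (auto simp: frobenius_complement_def dest: subgroup.mem_carrier)
  have "inv h \<otimes> a \<otimes> h = a"
    using aG h comm by (simp add: m_assoc inv_solve_left')
  then have "a \<in> A \<inter> conjugate G A h"
    using a by (auto simp: mem_conjugate_iff intro!: bexI[of _ a])
  moreover have "A \<inter> conjugate G A h = {\<one>}"
    using assms h \<open>h \<notin> A\<close> by (simp add: frobenius_complement_def)
  ultimately show False
    using a by blast
qed

lemma (in group) centralizer_closed_kernel:
  assumes A: "frobenius_complement G A"
  shows "centralizer_closed G (frobenius_kernel G A)"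
  unfolding centralizer_closed_def
proof (intro ballI impI, rule ccontr)
  fix x h
  assume x: "x \<in> frobenius_kernel G A - {\<one>}" and h: "h \<in> carrier G"
    and comm: "x \<otimes> h = h \<otimes> x" and hN: "h \<notin> frobenius_kernel G A"
  have xG: "x \<in> carrier G"
    using x by (auto simp: frobenius_kernel_def)
  obtain g b where g: "g \<in> carrier G" and b: "b \<in> A" and h_eq: "h = inv g \<otimes> b \<otimes> g"
    using hN h by (auto simp: frobenius_kernel_def mem_conjugate_iff)
  have bG: "b \<in> carrier G"
    using A b by (auto simp: frobenius_complement_def dest: subgroup.mem_carrier)
  have b_eq: "b = g \<otimes> h \<otimes> inv g"
    using bG g by (simp add: h_eq m_assoc flip: m_assoc[of g "inv g"])
  \<comment> \<open>The conjugation that takes \<open>h\<close> to \<open>b\<close> takes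
    \<open>x\<close> to \<open>y\<close>, so the commuting pair moves to one with a member in
    \<open>A\<close>.\<close>
  define y where "y = g \<otimes> x \<otimes> inv g"
  have yG: "y \<in> carrier G"
    using g xG by (simp add: y_def)
  have x_eq: "x = inv g \<otimes> y \<otimes> g"
    using g xG by (simp add: y_def m_assoc flip: m_assoc[of "inv g" g])
  \<comment> \<open>Otherwise \<open>h\<close> would be the identity, which belongs to the kernel by
    definition.\<close>
  have "b \<noteq> \<one>"
    using hN g by (auto simp: h_eq frobenius_kernel_def)
  moreover have "b \<otimes> y = y \<otimes> b"
  proof -
    have "b \<otimes> y = g \<otimes> (h \<otimes> x) \<otimes> inv g" "y \<otimes> b = g \<otimes> (x \<otimes> h) \<otimes> inv g"
      using g h xG by (simp_all add: b_eq y_def m_assoc flip: m_assoc[of "inv g" g])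
    then show ?thesis
      using comm by simp
  qed
  ultimately have "y \<in> A"
    using centralizer_closedD[OF centralizer_closed_complement[OF A] b] yG by blast
  then have "x \<in> conjugate G A g"
    using x_eq by (auto simp: mem_conjugate_iff)
  then show False
    using x g by (auto simp: frobenius_kernel_def)
qed

text \<open>\<open>A\<close> is its own conjugate by the identity, hence among the sets removed to
  form the kernel.\<close>

lemma (in group) complement_inter_kernel:
  assumes "frobenius_complement G A"
  shows "A \<inter> frobenius_kernel G A \<subseteq> {\<one>}"
  using assms conjugate_one[of A]
  by (auto simp: frobenius_kernel_def frobenius_complement_def dest: subgroup.subset)

text \<open>\<open>A\<close> is a complement only in \<open>L\<close>, so its own Frobenius property
  controls centralizers within \<open>L\<close>. The kernel of \<open>H Mod K\<close> first confines
  the centralizer in \<open>H\<close> to \<open>L\<close>.\<close>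

lemma two_frobenius_complement_centralizer_closed:
  assumes "group H" and KH: "K \<lhd> H" and "K \<subseteq> L" and "subgroup L H"
    and A: "frobenius_complement (H\<lparr>carrier := L\<rparr>) A"
    and K: "K = frobenius_kernel (H\<lparr>carrier := L\<rparr>) A"
    and LK: "frobenius_group_with_kernel (H Mod K) (carrier (H\<lparr>carrier := L\<rparr> Mod K))"
  shows "centralizer_closed H A"
  unfolding centralizer_closed_def
proof (intro ballI impI)
  interpret H: group H by fact
  interpret K: normal K H by fact
  interpret L: group "H\<lparr>carrier := L\<rparr>"
    using \<open>subgroup L H\<close> by (rule H.subgroup_imp_group)
  interpret HK: group "H Mod K"
    by (rule K.factorgroup_is_group)
  have LH: "L \<subseteq> carrier H"
    using \<open>subgroup L H\<close> by (rule subgroup.subset)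
  \<comment> \<open>Since \<open>K \<subseteq> L\<close>, the subgroup \<open>L\<close> is a union
    of cosets of \<open>K\<close>, so the coset of \<open>l\<close> decides whether \<open>l\<close>
    lies in \<open>L\<close>.\<close>
  have coset_mem: "K #>\<^bsub>H\<^esub> l \<in> carrier (H\<lparr>carrier := L\<rparr> Mod K) \<longleftrightarrow> l \<in> L"
    if l: "l \<in> carrier H" for l
  proof
    assume "K #>\<^bsub>H\<^esub> l \<in> carrier (H\<lparr>carrier := L\<rparr> Mod K)"
    then obtain m where m: "m \<in> L" and eq: "K #>\<^bsub>H\<^esub> l = K #>\<^bsub>H\<^esub> m"
      by (auto simp: FactGroup_def RCOSETS_def r_coset_def)
    have "l \<in> K #>\<^bsub>H\<^esub> m"
      using H.rcos_self[OF l K.subgroup_axioms] eq by simp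
    then obtain k where "k \<in> K" "l = k \<otimes>\<^bsub>H\<^esub> m"
      by (auto simp: r_coset_def)
    then show "l \<in> L"
      using \<open>K \<subseteq> L\<close> m subgroup.m_closed[OF \<open>subgroup L H\<close>] by blast
  qed (auto simp: FactGroup_def RCOSETS_def r_coset_def)
  fix a h
  assume a: "a \<in> A - {\<one>\<^bsub>H\<^esub>}" and h: "h \<in> carrier H"
    and comm: "a \<otimes>\<^bsub>H\<^esub> h = h \<otimes>\<^bsub>H\<^esub> a"
  have aL: "a \<in> L"
    using A a subgroup.subset[of A "H\<lparr>carrier := L\<rparr>"] by (auto simp: frobenius_complement_def)
  then have aH: "a \<in> carrier H"
    using LH by blast
  have "a \<notin> K"
    using L.complement_inter_kernel[OF A] a K by auto
  then have "K #>\<^bsub>H\<^esub> a \<noteq> K"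
    using H.coset_join1 aH K.subgroup_axioms by blast
  moreover have "centralizer_closed (H Mod K) (carrier (H\<lparr>carrier := L\<rparr> Mod K))"
    using LK HK.centralizer_closed_kernel by (auto simp: frobenius_group_with_kernel_def)
  moreover have "K #>\<^bsub>H\<^esub> h \<in> carrier (H Mod K)"
    using h by (auto simp: carrier_FactGroup)
  moreover have "(K #>\<^bsub>H\<^esub> a) \<otimes>\<^bsub>H Mod K\<^esub> (K #>\<^bsub>H\<^esub> h) = (K #>\<^bsub>H\<^esub> h) \<otimes>\<^bsub>H Mod K\<^esub> (K #>\<^bsub>H\<^esub> a)"
    using aH h comm by (simp add: K.rcos_sum)
  ultimately have "K #>\<^bsub>H\<^esub> h \<in> carrier (H\<lparr>carrier := L\<rparr> Mod K)"
    using centralizer_closedD[of "H Mod K" _ "K #>\<^bsub>H\<^esub> a" "K #>\<^bsub>H\<^esub> h"] aL coset_mem[OF aH] by simp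
  then have "h \<in> L"
    using coset_mem[OF h] by simp
  then show "h \<in> A"
    using centralizer_closedD[OF L.centralizer_closed_complement[OF A], of a h] a comm by simp
qed

text \<open>Adjacent vertices have commuting nontrivial images in the quotient, so membership of the
  image in \<open>S\<close> propagates along paths. The conditions on \<open>S\<close> provide a
  vertex over \<open>S\<close> and one outside it.\<close>

lemma (in group) disconnected_commuting_graph:
  assumes fin: "finite (carrier G)"
    and S: "centralizer_closed (G Mod center G) S"
    and sub: "S \<subset> carrier (G Mod center G)"
    and one: "center G \<in> S" and nontriv: "S \<noteq> {center G}"
  shows "disconnected (with_proj (commuting_graph G))"
proof -
  interpret Z: normal "center G" G
    by (rule center_normal)
  interpret pair_graph "commuting_graph G"
    using fin by (rule commuting_graph_pair_graph)
  have rep: "\<exists>x \<in> carrier G - center G. C = center G #> x"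
    if "C \<in> carrier (G Mod center G)" "C \<noteq> center G" for C
    using that coset_join2[OF _ Z.subgroup_axioms] by (auto simp: carrier_FactGroup)
  obtain u where u: "u \<in> carrier G - center G" "center G #> u \<in> S"
    using rep sub one nontriv by blast
  obtain v where v: "v \<in> carrier G - center G" "center G #> v \<notin> S"
    using rep sub one by blast
  have "center G #> w \<in> S" if "u \<rightarrow>\<^sup>*\<^bsub>with_proj (commuting_graph G)\<^esub> w" for w
    using that
  proof (induction rule: reachable_induct)
    case base
    show ?case by (fact u(2))
  next
    case (step x y)
    then have x: "x \<in> carrier G" "x \<notin> center G" and y: "y \<in> carrier G"
      and comm: "x \<otimes> y = y \<otimes> x"
      by (auto simp: commuting_graph_def)
    \<comment> \<open>Vertices are noncentral, so the image of \<open>x\<close> is not the identity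
      of the quotient and closedness of \<open>S\<close> applies to it.\<close>
    have "center G #> x \<noteq> center G"
      using coset_join1[OF _ x(1) Z.subgroup_axioms] x(2) by blast
    moreover have "(center G #> x) <#> (center G #> y) = (center G #> y) <#> (center G #> x)"
      using x y comm by (simp add: Z.rcos_sum)
    ultimately show ?case
      using centralizer_closedD[OF S step.IH, of "center G #> y"] y
      by (auto simp: carrier_FactGroup)
  qed
  then have "\<not> u \<rightarrow>\<^sup>*\<^bsub>with_proj (commuting_graph G)\<^esub> v"
    using v(2) by blast
  moreover have "u \<in> pverts (commuting_graph G)" "v \<in> pverts (commuting_graph G)"
    using u v by (simp_all add: commuting_graph_def)
  \<comment> \<open>\<open>connected\<close> disregards the direction of arcs; symmetry turns it
    into strong connectedness, which the unreachable \<open>v\<close> refutes.\<close>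
  moreover have "symmetric (with_proj (commuting_graph G))"
    by (rule sym_arcs)
  ultimately show ?thesis
    using symmetric_connected_imp_strongly_connected
    by (auto simp: disconnected_def strongly_connected_def)
qed

theorem theorem1:
  fixes G :: "('a, 'b) monoid_scheme"
  assumes "group G"
    and "finite (carrier G)"
    and "frobenius_group (G Mod center G) \<or> two_frobenius_group (G Mod center G)"
  shows "disconnected (with_proj (commuting_graph G))"
proof -
  interpret group G by fact
  let ?H = "G Mod center G"
  interpret H: group ?H
    using center_normal by (rule normal.factorgroup_is_group)
  \<comment> \<open>The witness is a Frobenius complement, of \<open>?H\<close> in the first case
    and of \<open>L\<close> in the second.\<close>
  have "\<exists>S. centralizer_closed ?H S \<and> S \<subset> carrier ?H \<and> \<one>\<^bsub>?H\<^esub> \<in> S \<and> S \<noteq> {\<one>\<^bsub>?H\<^esub>}"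
    using assms(3)
  proof
    assume "frobenius_group ?H"
    then obtain A where A: "frobenius_complement ?H A"
      by (auto simp: frobenius_group_def)
    then show ?thesis
      using H.centralizer_closed_complement[OF A] subgroup.subset[of A ?H]
        subgroup.one_closed[of A ?H]
      unfolding frobenius_complement_def by blast
  next
    assume "two_frobenius_group ?H"
    \<comment> \<open>The Frobenius structure is unfolded only for \<open>L\<close>, to expose
      \<open>A\<close>; that of \<open>?H Mod K\<close> stays folded as \<open>LK\<close>.\<close>
    then obtain K L A where K: "K \<lhd> ?H" and L: "L \<lhd> ?H" and "K \<subseteq> L"
      and A: "frobenius_complement (?H\<lparr>carrier := L\<rparr>) A"
      and K_eq: "K = frobenius_kernel (?H\<lparr>carrier := L\<rparr>) A"
      and LK: "frobenius_group_with_kernel (?H Mod K) (carrier (?H\<lparr>carrier := L\<rparr> Mod K))"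
      unfolding two_frobenius_group_def frobenius_group_with_kernel_def[of "_\<lparr>carrier := _\<rparr>"]
      by blast
    have LH: "subgroup L ?H"
      using L by (rule normal_imp_subgroup)
    have "centralizer_closed ?H A"
      using H.is_group K \<open>K \<subseteq> L\<close> LH A K_eq LK
      by (rule two_frobenius_complement_centralizer_closed)
    moreover have "A \<subseteq> L" "\<one>\<^bsub>?H\<^esub> \<in> A" "A \<noteq> {\<one>\<^bsub>?H\<^esub>}" "A \<noteq> L"
      using A subgroup.subset[of A "?H\<lparr>carrier := L\<rparr>"]
        subgroup.one_closed[of A "?H\<lparr>carrier := L\<rparr>"]
      by (auto simp: frobenius_complement_def)
    ultimately show ?thesis
      using subgroup.subset[OF LH] by blast
  qed
  then show ?thesis
    using disconnected_commuting_graph[OF assms(2)] by auto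
qed

end
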